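(* In the isoperimetric control setting of the context, let $V(B)=\sup\{J(u):u\in\mathcal U,\ \mathcal C(u)=B\}$ for $B\in\mathbb R$, with $V(B)=-\infty$ for $B\notin\operatorname{dom}V:=\{\mathcal C(u):u\in\mathcal U\}$, so that $V$ is defined on all of $\mathbb R$. Assume that $V$ is proper, concave, upper semicontinuous, and finite on $\operatorname{int}(\operatorname{dom}V)$. Define $$\ell(\mu):=\sup_{u\in\mathcal U}\{J(u)+\mu\,\mathcal C(u)\},\qquad \mu\in\mathbb R.$$ Then, for every $B\in\operatorname{int}(\operatorname{dom}V)$, $$V(B)=\inf_{\mu\in\mathbb R}\{\ell(\mu)-\mu B\}.$$
   Context: Setting. Fix $T>0$, $x_0\in\mathbb R^n$, $U\subset\mathbb R^m$, and $\mathcal U=\{u\in L^\infty(0,T;\mathbb R^m):u(t)\in U\text{ for a.e. }t\}$. The data $g:[0,T]\times\mathbb R^n\times\mathbb R^m\to\mathbb R^n$ and $f,h:[0,T]\times\mathbb R^n\times\mathbb R^m\to\mathbb R$ are measurable in $t$ and $C^1$ in $(x,u)$ for a.e. $t$; $g$ is Lipschitz in $x$ with a constant $L$ uniform in $u\in U$ and a.e. $t$; for some $c>0$, $\|g(t,x,u)\|\le c(1+\|x\|+\|u\|)$ and $|f(t,x,u)|,|h(t,x,u)|\le c(1+\|x\|^2+\|u\|^2)$ on $[0,T]\times\mathbb R^n\times U$; $\phi\in C^1(\mathbb R^n)$ with $|\phi(x)|\le c(1+\|x\|^2)$. For $u\in\mathcal U$, $x_u$ is the unique solution of $\dot x=g(t,x,u(t))$,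 $x(0)=x_0$; $J(u)=\int_0^Tf(t,x_u,u)\,dt+\phi(x_u(T))$ and $\mathcal C(u)=\int_0^Th(t,x_u,u)\,dt$ (both real-valued on $\mathcal U$). "Proper" for the concave function $V$ means $V<+\infty$ everywhere and $V>-\infty$ somewhere. *)

theory Defs
  imports "HOL-Analysis.Analysis"
begin

definition absolutely_continuous_on_interval ::
    "real \<Rightarrow> real \<Rightarrow> (real \<Rightarrow> 'a::metric_space) \<Rightarrow> bool" where
  "absolutely_continuous_on_interval a b x \<longleftrightarrow>
    (\<forall>\<epsilon>>0. \<exists>\<delta>>0. \<forall>(k::nat) p q.
       (\<forall>i<k. a \<le> p i \<and> p i \<le> q i \<and> q i \<le> b) \<and>
       (\<forall>i<k. \<forall>j<k. i \<noteq> j \<longrightarrow> {p i<..<q i} \<inter> {p j<..<q j} = {}) \<and>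
       (\<Sum>i<k. q i - p i) < \<delta>
       \<longrightarrow> (\<Sum>i<k. dist (x (q i)) (x (p i))) < \<epsilon>)"

definition continuously_differentiable ::
    "('a::real_normed_vector \<Rightarrow> 'b::real_normed_vector) \<Rightarrow> bool" where
  "continuously_differentiable F \<longleftrightarrow>
    (\<exists>F' :: 'a \<Rightarrow> 'a \<Rightarrow>\<^sub>L 'b.
       (\<forall>z. (F has_derivative blinfun_apply (F' z)) (at z)) \<and> continuous_on UNIV F')"

(* Elements of L^\<infinity>(0,T) are represented by functions on the whole line. Only the
   almost-everywhere class of their restriction to [0,T] matters: every notion below
   gives the same result for two representatives of one class. *)
definition admissible_controls ::
    "real \<Rightarrow> (real ^ 'm) set \<Rightarrow> (real \<Rightarrow> real ^ 'm) set" where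
  "admissible_controls T U =
    {u. u \<in> borel_measurable (lebesgue_on {0..T}) \<and>
        (\<exists>K. AE t in lebesgue_on {0..T}. norm (u t) \<le> K) \<and>
        (AE t in lebesgue_on {0..T}. u t \<in> U)}"

definition is_trajectory ::
    "real \<Rightarrow> real ^ 'n \<Rightarrow> (real \<Rightarrow> real ^ 'n \<Rightarrow> real ^ 'm \<Rightarrow> real ^ 'n) \<Rightarrow>
     (real \<Rightarrow> real ^ 'm) \<Rightarrow> (real \<Rightarrow> real ^ 'n) \<Rightarrow> bool" where
  "is_trajectory T x0 g u x \<longleftrightarrow>
    absolutely_continuous_on_interval 0 T x \<and> x 0 = x0 \<and>
    (AE t in lebesgue_on {0..T}.
       (x has_vector_derivative g t (x t) (u t)) (at t within {0..T}))"

(* The differential equation determines the state only on [0,T]; extensionality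
   fixes the values elsewhere, so that the description is unique. *)
definition trajectory ::
    "real \<Rightarrow> real ^ 'n \<Rightarrow> (real \<Rightarrow> real ^ 'n \<Rightarrow> real ^ 'm \<Rightarrow> real ^ 'n) \<Rightarrow>
     (real \<Rightarrow> real ^ 'm) \<Rightarrow> real \<Rightarrow> real ^ 'n" where
  "trajectory T x0 g u = (THE x. x \<in> extensional {0..T} \<and> is_trajectory T x0 g u x)"

definition running_integral ::
    "real \<Rightarrow> real ^ 'n \<Rightarrow> (real \<Rightarrow> real ^ 'n \<Rightarrow> real ^ 'm \<Rightarrow> real ^ 'n) \<Rightarrow>
     (real \<Rightarrow> real ^ 'n \<Rightarrow> real ^ 'm \<Rightarrow> real) \<Rightarrow> (real \<Rightarrow> real ^ 'm) \<Rightarrow> real" where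
  "running_integral T x0 g f u = (LINT t:{0..T}|lebesgue. f t (trajectory T x0 g u t) (u t))"

definition objective ::
    "real \<Rightarrow> real ^ 'n \<Rightarrow> (real \<Rightarrow> real ^ 'n \<Rightarrow> real ^ 'm \<Rightarrow> real ^ 'n) \<Rightarrow>
     (real \<Rightarrow> real ^ 'n \<Rightarrow> real ^ 'm \<Rightarrow> real) \<Rightarrow> (real ^ 'n \<Rightarrow> real) \<Rightarrow>
     (real \<Rightarrow> real ^ 'm) \<Rightarrow> real" where
  "objective T x0 g f \<phi> u = running_integral T x0 g f u + \<phi> (trajectory T x0 g u T)"

abbreviation constraint ::
    "real \<Rightarrow> real ^ 'n \<Rightarrow> (real \<Rightarrow> real ^ 'n \<Rightarrow> real ^ 'm \<Rightarrow> real ^ 'n) \<Rightarrow>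
     (real \<Rightarrow> real ^ 'n \<Rightarrow> real ^ 'm \<Rightarrow> real) \<Rightarrow> (real \<Rightarrow> real ^ 'm) \<Rightarrow> real" where
  "constraint \<equiv> running_integral"

definition attainable_budgets ::
    "real \<Rightarrow> real ^ 'n \<Rightarrow> (real ^ 'm) set \<Rightarrow>
     (real \<Rightarrow> real ^ 'n \<Rightarrow> real ^ 'm \<Rightarrow> real ^ 'n) \<Rightarrow>
     (real \<Rightarrow> real ^ 'n \<Rightarrow> real ^ 'm \<Rightarrow> real) \<Rightarrow> real set" where
  "attainable_budgets T x0 U g h = constraint T x0 g h ` admissible_controls T U"

(* For B outside attainable_budgets the index set is empty, and the supremum of the
   empty set in ereal is -\<infinity>. *)
definition value_function ::
    "real \<Rightarrow> real ^ 'n \<Rightarrow> (real ^ 'm) set \<Rightarrow>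
     (real \<Rightarrow> real ^ 'n \<Rightarrow> real ^ 'm \<Rightarrow> real ^ 'n) \<Rightarrow>
     (real \<Rightarrow> real ^ 'n \<Rightarrow> real ^ 'm \<Rightarrow> real) \<Rightarrow>
     (real \<Rightarrow> real ^ 'n \<Rightarrow> real ^ 'm \<Rightarrow> real) \<Rightarrow> (real ^ 'n \<Rightarrow> real) \<Rightarrow>
     real \<Rightarrow> ereal" where
  "value_function T x0 U g f h \<phi> B =
    (SUP u \<in> {u \<in> admissible_controls T U. constraint T x0 g h u = B}.
       ereal (objective T x0 g f \<phi> u))"

definition lagrangian_value ::
    "real \<Rightarrow> real ^ 'n \<Rightarrow> (real ^ 'm) set \<Rightarrow>
     (real \<Rightarrow> real ^ 'n \<Rightarrow> real ^ 'm \<Rightarrow> real ^ 'n) \<Rightarrow>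
     (real \<Rightarrow> real ^ 'n \<Rightarrow> real ^ 'm \<Rightarrow> real) \<Rightarrow>
     (real \<Rightarrow> real ^ 'n \<Rightarrow> real ^ 'm \<Rightarrow> real) \<Rightarrow> (real ^ 'n \<Rightarrow> real) \<Rightarrow>
     real \<Rightarrow> ereal" where
  "lagrangian_value T x0 U g f h \<phi> \<mu> =
    (SUP u \<in> admissible_controls T U.
       ereal (objective T x0 g f \<phi> u + \<mu> * constraint T x0 g h u))"

definition proper_concave_sense :: "('a \<Rightarrow> ereal) \<Rightarrow> bool" where
  "proper_concave_sense F \<longleftrightarrow> (\<forall>z. F z < \<infinity>) \<and> (\<exists>z. F z > -\<infinity>)"

(* Convexity of the hypograph; this avoids the expression \<infinity> + (-\<infinity>), which is
   \<infinity> in ereal, in the inequality form of concavity. *)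
definition ereal_concave :: "('a::real_vector \<Rightarrow> ereal) \<Rightarrow> bool" where
  "ereal_concave F \<longleftrightarrow> convex {(z, r::real). ereal r \<le> F z}"

definition upper_semicontinuous :: "('a::topological_space \<Rightarrow> ereal) \<Rightarrow> bool" where
  "upper_semicontinuous F \<longleftrightarrow> (\<forall>z. Limsup (at z) F \<le> F z)"

end

theory Submission
  imports Defs
begin

text \<open>
  Weak duality is immediate. For the converse, a concave function has a supergradient
  \<open>s\<close> at each interior point \<open>B\<close> of its domain, and the multiplier \<open>- s\<close> attains the infimum.
\<close>

text \<open>Where \<open>F\<close> exceeds -\<infinity> it is real-valued, and there
  \<open>- F\<close> is an ordinary convex function, whose graph lies above a supporting line at
  every interior point. Elsewhere \<open>F\<close> is -\<infinity> and any line dominates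
  it.\<close>

lemma ereal_concave_supergradient:
  fixes F :: "real \<Rightarrow> ereal"
  assumes concave: "ereal_concave F" and lt_top: "\<And>z. F z < \<infinity>"
    and B: "B \<in> interior {z. F z > -\<infinity>}"
  obtains s where "\<And>b. F b \<le> F B + ereal (s * (b - B))"
proof -
  define D where "D = {z. F z > -\<infinity>}"
  define v where "v z = real_of_ereal (F z)" for z
  have Fv: "F z = ereal (v z)" if "z \<in> D" for z
    using that lt_top[of z] by (cases "F z") (auto simp: D_def v_def)
  \<comment> \<open>The points \<open>(x, v x)\<close> and \<open>(y, v y)\<close> of the graph lie
    in the convex hypograph. The left side is a real number, so the same bound later also forces
    \<open>F\<close> above -\<infinity> at the convex combination.\<close>
  have hyp: "ereal ((1 - t) * v x + t * v y) \<le> F ((1 - t) * x + t * y)"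
    if "x \<in> D" "y \<in> D" "0 \<le> t" "t \<le> 1" for x y t
  proof -
    have "(1 - t) *\<^sub>R (x, v x) + t *\<^sub>R (y, v y) \<in> {(z, r::real). ereal r \<le> F z}"
      using concave[unfolded ereal_concave_def] that Fv by (intro convexD_alt) auto
    then show ?thesis by simp
  qed
  have D_convex: "convex D"
    unfolding convex_alt
  proof (intro ballI allI impI)
    fix x y t :: real
    assume "x \<in> D" "y \<in> D" "0 \<le> t \<and> t \<le> 1"
    with hyp[of x y t] show "(1 - t) *\<^sub>R x + t *\<^sub>R y \<in> D"
      by (auto simp: D_def intro: less_le_trans[rotated])
  qed
  have "convex_on D (\<lambda>z. - v z)"
  proof (rule convex_onI)
    fix t x y :: real
    assume t: "0 < t" "t < 1" and xy: "x \<in> D" "y \<in> D"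
    then have "(1 - t) * x + t * y \<in> D"
      using convexD_alt[OF D_convex, of x y t] by simp
    with hyp[of x y t] t xy
    show "- v ((1 - t) *\<^sub>R x + t *\<^sub>R y) \<le> (1 - t) * - v x + t * - v y"
      by (simp add: Fv)
  qed (rule D_convex)
  note diff = convex_le_Inf_differential[OF this B[folded D_def]]
  \<comment> \<open>The difference quotients of the convex function \<open>- v\<close> increase with
    \<open>t\<close>, so their infimum to the right of \<open>B\<close> is its right derivative at
    \<open>B\<close>; thus \<open>s\<close> is the right derivative of \<open>v\<close>
    there.\<close>
  define s where "s = - Inf ((\<lambda>t. (- v B - - v t) / (B - t)) ` ({B<..} \<inter> D))"
  have BD: "B \<in> D"
    using B interior_subset unfolding D_def by blast
  show thesis
  proof (rule that)
    fix b
    show "F b \<le> F B + ereal (s * (b - B))"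
    proof (cases "b \<in> D")
      case True
      with diff[OF this] BD show ?thesis
        by (simp add: Fv s_def)
    next
      case False
      then show ?thesis by (simp add: D_def)
    qed
  qed
qed

theorem theorem3p7:
  fixes T :: real and x0 :: "real ^ 'n" and U :: "(real ^ 'm) set"
    and g :: "real \<Rightarrow> real ^ 'n \<Rightarrow> real ^ 'm \<Rightarrow> real ^ 'n"
    and f h :: "real \<Rightarrow> real ^ 'n \<Rightarrow> real ^ 'm \<Rightarrow> real"
    and \<phi> :: "real ^ 'n \<Rightarrow> real"
    and L c B :: real
  assumes "T > 0"
    and g_meas: "\<And>x u. (\<lambda>t. g t x u) \<in> borel_measurable (lebesgue_on {0..T})"
    and f_meas: "\<And>x u. (\<lambda>t. f t x u) \<in> borel_measurable (lebesgue_on {0..T})"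
    and h_meas: "\<And>x u. (\<lambda>t. h t x u) \<in> borel_measurable (lebesgue_on {0..T})"
    and g_C1: "AE t in lebesgue_on {0..T}. continuously_differentiable (\<lambda>(x, u). g t x u)"
    and f_C1: "AE t in lebesgue_on {0..T}. continuously_differentiable (\<lambda>(x, u). f t x u)"
    and h_C1: "AE t in lebesgue_on {0..T}. continuously_differentiable (\<lambda>(x, u). h t x u)"
    and g_Lipschitz: "AE t in lebesgue_on {0..T}. \<forall>u\<in>U. L-lipschitz_on UNIV (\<lambda>x. g t x u)"
    and "c > 0"
    and g_growth: "\<And>t x u. t \<in> {0..T} \<Longrightarrow> u \<in> U \<Longrightarrow> norm (g t x u) \<le> c * (1 + norm x + norm u)"
    and f_growth: "\<And>t x u. t \<in> {0..T} \<Longrightarrow> u \<in> U \<Longrightarrow> \<bar>f t x u\<bar> \<le> c * (1 + (norm x)\<^sup>2 + (norm u)\<^sup>2)"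
    and h_growth: "\<And>t x u. t \<in> {0..T} \<Longrightarrow> u \<in> U \<Longrightarrow> \<bar>h t x u\<bar> \<le> c * (1 + (norm x)\<^sup>2 + (norm u)\<^sup>2)"
    and phi_C1: "continuously_differentiable \<phi>"
    and phi_growth: "\<And>x. \<bar>\<phi> x\<bar> \<le> c * (1 + (norm x)\<^sup>2)"
    and V_proper: "proper_concave_sense (value_function T x0 U g f h \<phi>)"
    and V_concave: "ereal_concave (value_function T x0 U g f h \<phi>)"
    and V_usc: "upper_semicontinuous (value_function T x0 U g f h \<phi>)"
    and V_finite: "\<And>b. b \<in> interior (attainable_budgets T x0 U g h) \<Longrightarrow>
                     \<bar>value_function T x0 U g f h \<phi> b\<bar> \<noteq> \<infinity>"
    and B_interior: "B \<in> interior (attainable_budgets T x0 U g h)"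
  shows "value_function T x0 U g f h \<phi> B =
         (INF \<mu>. lagrangian_value T x0 U g f h \<phi> \<mu> - ereal (\<mu> * B))"
proof -
  define V where "V = value_function T x0 U g f h \<phi>"
  define D where "D = attainable_budgets T x0 U g h"
  define A where "A = admissible_controls T U"
  define J where "J = objective T x0 g f \<phi>"
  define C where "C = constraint T x0 g h"
  have J_le_V: "ereal (J u) \<le> V (C u)" if "u \<in> A" for u
    using that unfolding V_def J_def C_def A_def value_function_def by (intro SUP_upper) auto
  \<comment> \<open>On controls with \<open>C u = B\<close> the term \<open>\<mu> * C u\<close> is
    the constant \<open>\<mu> * B\<close>. This constant is finite, so it can be moved across the
    inequality even if the Lagrangian value is infinite.\<close>
  have weak: "V B \<le> lagrangian_value T x0 U g f h \<phi> \<mu> - ereal (\<mu> * B)" for \<mu>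
    unfolding V_def value_function_def
  proof (intro SUP_least)
    fix u assume "u \<in> {u \<in> admissible_controls T U. constraint T x0 g h u = B}"
    then have u: "u \<in> A" "C u = B" by (auto simp: A_def C_def)
    have "ereal (J u + \<mu> * C u) \<le> lagrangian_value T x0 U g f h \<phi> \<mu>"
      using u(1) unfolding lagrangian_value_def A_def J_def C_def by (rule SUP_upper)
    then show "ereal (objective T x0 g f \<phi> u) \<le> lagrangian_value T x0 U g f h \<phi> \<mu> - ereal (\<mu> * B)"
      using u(2) by (simp add: ereal_le_minus J_def)
  qed
  \<comment> \<open>An attainable budget is met by a control with a real objective, which bounds
    \<open>V\<close> below. By monotonicity of the interior, \<open>B\<close> then satisfies the
    hypothesis of the supergradient lemma.\<close>
  have "D \<subseteq> {z. V z > -\<infinity>}"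
  proof
    fix z assume "z \<in> D"
    then obtain u where "u \<in> A" "C u = z"
      by (auto simp: D_def attainable_budgets_def A_def C_def)
    with J_le_V[of u] show "z \<in> {z. V z > -\<infinity>}"
      by (auto intro: less_le_trans[rotated])
  qed
  then have "B \<in> interior {z. V z > -\<infinity>}"
    using B_interior interior_mono unfolding D_def by blast
  then obtain s where s: "\<And>b. V b \<le> V B + ereal (s * (b - B))"
    using ereal_concave_supergradient[of V B] V_concave V_proper
    unfolding V_def proper_concave_sense_def by blast
  have "\<bar>V B\<bar> \<noteq> \<infinity>"
    using V_finite[OF B_interior] by (simp add: V_def)
  then obtain r where r: "V B = ereal r" by (cases "V B") auto
  \<comment> \<open>Every control competes in the supremum defining \<open>V\<close> at its own
    budget, so the supergradient inequality at \<open>b = C u\<close> bounds \<open>J u\<close> for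
    all controls at once. The bound \<open>r - s * B\<close> is the intercept at budget 0 of the
    supporting line at \<open>B\<close>.\<close>
  have "lagrangian_value T x0 U g f h \<phi> (- s) \<le> ereal (r - s * B)"
    unfolding lagrangian_value_def
  proof (rule SUP_least)
    fix u assume "u \<in> admissible_controls T U"
    then have "ereal (J u) \<le> V B + ereal (s * (C u - B))"
      using J_le_V s order_trans unfolding A_def by blast
    then have "J u + - s * C u \<le> r - s * B"
      by (simp add: r algebra_simps)
    then show "ereal (objective T x0 g f \<phi> u + - s * constraint T x0 g h u) \<le> ereal (r - s * B)"
      by (simp add: J_def C_def)
  qed
  \<comment> \<open>Subtracting \<open>- s * B\<close> evaluates the supporting line at
    \<open>B\<close> itself, where it equals \<open>r\<close>, so the infimum is bounded through its
    member at \<open>\<mu> = - s\<close>.\<close>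
  then have "lagrangian_value T x0 U g f h \<phi> (- s) - ereal (- s * B) \<le> V B"
    by (simp add: ereal_minus_le r)
  then have "(INF \<mu>. lagrangian_value T x0 U g f h \<phi> \<mu> - ereal (\<mu> * B)) \<le> V B"
    by (rule INF_lower2[OF UNIV_I])
  moreover have "V B \<le> (INF \<mu>. lagrangian_value T x0 U g f h \<phi> \<mu> - ereal (\<mu> * B))"
    using weak by (rule INF_greatest)
  ultimately show ?thesis unfolding V_def by (rule antisym[rotated])
qed

end
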